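(* Let $\alpha\ge2$ and $q:=\frac{\alpha}{\alpha-1}$, and let $\{e_k\}_{k=2}^\infty$ be the canonical unit-vector basis of $\ell^q$. Let $p_k:=\frac{C_0}{k(\log k)^2}$ for $k\ge2$, where $C_0:=\big(\sum_{k=2}^\infty\frac1{k(\log k)^2}\big)^{-1}$. Let $K$ be a random variable with $\mathbb{P}(K=k)=p_k$, $k\ge2$, let $\varepsilon$ be independent of $K$ with $\mathbb{P}(\varepsilon=1)=\mathbb{P}(\varepsilon=-1)=\frac12$, and set $Z:=\varepsilon e_K$. Let $\{Z_j\}_{j=1}^\infty$ be i.i.d. copies of $Z$ and $\bar Z_N:=\frac1N\sum_{j=1}^NZ_j$. Then there exists $N_0\in\mathbb{N}$ such that, for every $N\ge N_0$, $$N^{-\frac1{\alpha-1}}(\log N)^{-1}\lesssim\mathbb{E}\|\bar Z_N\|_{\ell^q}^q\lesssim N^{-\frac1{\alpha-1}}.$$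
   Context: $\ell^q$ is the space of real $q$-summable sequences indexed by $k\ge2$. $a\lesssim b$ means $a\le Cb$ with a constant $C>0$ independent of $N$. *)

theory Defs
  imports "HOL-Probability.Probability"
begin

text \<open>
  Real sequences indexed by \<open>k \<ge> 2\<close> are functions on \<^typ>\<open>nat\<close>; members of \<open>lq_space q\<close>
  vanish at \<open>0\<close> and \<open>1\<close>, so that extensional equality is equality of sequences.
\<close>

definition lq_space :: "real \<Rightarrow> (nat \<Rightarrow> real) set" where
  "lq_space q = {x. (\<forall>k<2. x k = 0) \<and> (\<lambda>k. \<bar>x k\<bar> powr q) summable_on {2..}}"

definition lq_norm :: "real \<Rightarrow> (nat \<Rightarrow> real) \<Rightarrow> real" where
  "lq_norm q x = (\<Sum>\<^sub>\<infinity>k\<in>{2..}. \<bar>x k\<bar> powr q) powr (1 / q)"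

definition lq_dist :: "real \<Rightarrow> (nat \<Rightarrow> real) \<Rightarrow> (nat \<Rightarrow> real) \<Rightarrow> real" where
  "lq_dist q x y = lq_norm q (\<lambda>k. x k - y k)"

definition lq_borel :: "real \<Rightarrow> (nat \<Rightarrow> real) measure" where
  "lq_borel q =
     sigma (lq_space q) {U. openin (Metric_space.mtopology (lq_space q) (lq_dist q)) U}"

definition unit_vec :: "nat \<Rightarrow> nat \<Rightarrow> real" where
  "unit_vec k = (\<lambda>i. if i = k then 1 else 0)"

definition C0 :: real where
  "C0 = inverse (\<Sum>\<^sub>\<infinity>k\<in>{2::nat..}. 1 / (real k * (ln (real k))\<^sup>2))"

definition p_seq :: "nat \<Rightarrow> real" where
  "p_seq k = C0 / (real k * (ln (real k))\<^sup>2)"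

text \<open>
  The locale operations of \<^locale>\<open>Metric_space\<close> used in \<open>lq_borel\<close> are meaningful because, for
  \<open>q \<ge> 1\<close>, \<open>lq_dist q\<close> is a metric on \<open>lq_space q\<close> (Minkowski's inequality).
\<close>

lemma convex_on_powr_ge_0:
  fixes q :: real
  assumes "q \<ge> 1"
  shows "convex_on {0..} (\<lambda>x. x powr q)"
proof (rule convex_onI)
  fix t x y :: real
  assume t: "0 < t" "t < 1" and xy: "x \<in> {0..}" "y \<in> {0..}"
  have le: "(s * z) powr q \<le> s * z powr q" if "0 < s" "s < 1" "0 \<le> z" for s z :: real
  proof -
    have "s powr q \<le> s powr 1"
      using that assms by (intro powr_mono') auto
    then show ?thesis
      using that by (simp add: powr_mult mult_right_mono)
  qed
  show "((1 - t) *\<^sub>R x + t *\<^sub>R y) powr q \<le> (1 - t) * x powr q + t * y powr q"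
  proof (cases "x = 0 \<or> y = 0")
    case True
    then show ?thesis
      using le[of t y] le[of "1 - t" x] t xy assms by auto
  next
    case False
    then show ?thesis
      using convex_onD[OF powr_convex[OF assms], of t x y] t xy by auto
  qed
qed auto

lemma lq_norm_nonneg: "0 \<le> lq_norm q x"
  by (simp add: lq_norm_def)

lemma lq_norm_powr:
  assumes "q > 0"
  shows "lq_norm q x powr q = (\<Sum>\<^sub>\<infinity>k\<in>{2..}. \<bar>x k\<bar> powr q)"
  using assms infsum_nonneg[of "{2..}" "\<lambda>k. \<bar>x k\<bar> powr q"]
  by (simp add: lq_norm_def powr_powr)

lemma lq_norm_eq_0D:
  assumes "x \<in> lq_space q" "lq_norm q x = 0"
  shows "x = (\<lambda>_. 0)"
proof
  fix k
  have "\<bar>x k\<bar> powr q = 0" if "2 \<le> k"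
    using assms that
    by (intro nonneg_infsum_le_0D[of "\<lambda>k. \<bar>x k\<bar> powr q" "{2..}"])
      (auto simp: lq_norm_def lq_space_def)
  then show "x k = 0"
    using assms by (cases "k < 2") (auto simp: lq_space_def)
qed

lemma lq_Minkowski:
  assumes q: "q \<ge> 1" and x: "x \<in> lq_space q" and y: "y \<in> lq_space q"
  shows "(\<lambda>k. x k + y k) \<in> lq_space q"
    and "lq_norm q (\<lambda>k. x k + y k) \<le> lq_norm q x + lq_norm q y"
proof -
  define a b where "a = lq_norm q x" and "b = lq_norm q y"
  have "(\<lambda>k. x k + y k) \<in> lq_space q \<and> lq_norm q (\<lambda>k. x k + y k) \<le> a + b"
  proof (cases "a = 0 \<or> b = 0")
    case True
    then have "x = (\<lambda>_. 0) \<or> y = (\<lambda>_. 0)"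
      using lq_norm_eq_0D x y by (auto simp: a_def b_def)
    then show ?thesis
      using x y by (auto simp: a_def b_def lq_norm_nonneg)
  next
    case False
    then have ab: "a > 0" "b > 0"
      using lq_norm_nonneg[of q x] lq_norm_nonneg[of q y] by (auto simp: a_def b_def)
    define t where "t = b / (a + b)"
    have t: "0 \<le> t" "t \<le> 1" "1 - t = a / (a + b)"
      using ab by (auto simp: t_def field_simps)
    define A B where "A = (a + b) powr q * (1 - t) / a powr q"
      and "B = (a + b) powr q * t / b powr q"
    let ?g = "\<lambda>k. A * \<bar>x k\<bar> powr q + B * \<bar>y k\<bar> powr q"
    have sx: "(\<lambda>k. \<bar>x k\<bar> powr q) summable_on {2..}"
      and sy: "(\<lambda>k. \<bar>y k\<bar> powr q) summable_on {2..}"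
      using x y by (auto simp: lq_space_def)
    have le: "\<bar>x k + y k\<bar> powr q \<le> ?g k" for k
    proof -
      have "(1 - t) * (\<bar>x k\<bar> / a) + t * (\<bar>y k\<bar> / b) = (\<bar>x k\<bar> + \<bar>y k\<bar>) / (a + b)"
        using ab unfolding t(3) by (simp add: t_def add_divide_distrib)
      then have "\<bar>x k + y k\<bar> \<le> (a + b) * ((1 - t) * (\<bar>x k\<bar> / a) + t * (\<bar>y k\<bar> / b))"
        using ab by simp
      then have "\<bar>x k + y k\<bar> powr q
          \<le> ((a + b) * ((1 - t) * (\<bar>x k\<bar> / a) + t * (\<bar>y k\<bar> / b))) powr q"
        using q by (intro powr_mono2) auto
      also have "\<dots> = (a + b) powr q * ((1 - t) * (\<bar>x k\<bar> / a) + t * (\<bar>y k\<bar> / b)) powr q"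
        using ab t by (subst powr_mult) auto
      also have "\<dots> \<le> (a + b) powr q
          * ((1 - t) * (\<bar>x k\<bar> / a) powr q + t * (\<bar>y k\<bar> / b) powr q)"
        using convex_onD[OF convex_on_powr_ge_0[OF q], of t "\<bar>x k\<bar> / a" "\<bar>y k\<bar> / b"] t ab
        by (intro mult_left_mono) auto
      also have "\<dots> = ?g k"
        using ab by (simp add: powr_divide A_def B_def algebra_simps)
      finally show ?thesis .
    qed
    have sg: "?g summable_on {2..}"
      using sx sy by (intro summable_on_add summable_on_cmult_right) auto
    have s: "(\<lambda>k. \<bar>x k + y k\<bar> powr q) summable_on {2..}"
      by (rule summable_on_comparison_test[OF sg]) (use le in auto)
    have "(\<Sum>\<^sub>\<infinity>k\<in>{2..}. \<bar>x k + y k\<bar> powr q) \<le> infsum ?g {2..}"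
      by (rule infsum_mono[OF s sg le])
    also have "\<dots> = A * a powr q + B * b powr q"
      using sx sy q
      by (simp add: infsum_add summable_on_cmult_right infsum_cmult_right a_def b_def lq_norm_powr)
    also have "\<dots> = (a + b) powr q"
    proof -
      have "A * a powr q = (a + b) powr q * (1 - t)" "B * b powr q = (a + b) powr q * t"
        using ab by (simp_all add: A_def B_def)
      then show ?thesis
        by (simp add: algebra_simps)
    qed
    finally have "(\<Sum>\<^sub>\<infinity>k\<in>{2..}. \<bar>x k + y k\<bar> powr q) \<le> (a + b) powr q" .
    then have "lq_norm q (\<lambda>k. x k + y k) \<le> ((a + b) powr q) powr (1 / q)"
      unfolding lq_norm_def using q by (intro powr_mono2) (auto intro!: infsum_nonneg)
    also have "\<dots> = a + b"
      using q ab by (simp add: powr_powr)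
    finally show ?thesis
      using s x y by (auto simp: lq_space_def)
  qed
  then show "(\<lambda>k. x k + y k) \<in> lq_space q"
    and "lq_norm q (\<lambda>k. x k + y k) \<le> lq_norm q x + lq_norm q y"
    by (auto simp: a_def b_def)
qed

lemma lq_diff:
  assumes "q \<ge> 1" "x \<in> lq_space q" "y \<in> lq_space q"
  shows "(\<lambda>k. x k - y k) \<in> lq_space q"
  using lq_Minkowski(1)[of q x "\<lambda>k. - y k"] assms by (auto simp: lq_space_def)

lemma Metric_space_lq:
  assumes q: "q \<ge> 1"
  shows "Metric_space (lq_space q) (lq_dist q)"
proof
  fix x y z
  show "0 \<le> lq_dist q x y"
    by (simp add: lq_dist_def lq_norm_nonneg)
  show "lq_dist q x y = lq_dist q y x"
    by (simp add: lq_dist_def lq_norm_def abs_minus_commute)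
  assume x: "x \<in> lq_space q" and y: "y \<in> lq_space q"
  show "lq_dist q x y = 0 \<longleftrightarrow> x = y"
  proof
    assume "lq_dist q x y = 0"
    then show "x = y"
      using lq_norm_eq_0D[OF lq_diff[OF q x y]] by (auto simp: lq_dist_def fun_eq_iff)
  qed (auto simp: lq_dist_def lq_norm_def)
  assume z: "z \<in> lq_space q"
  show "lq_dist q x z \<le> lq_dist q x y + lq_dist q y z"
    using lq_Minkowski(2)[OF q lq_diff[OF q x y] lq_diff[OF q y z]] by (simp add: lq_dist_def)
qed

end

theory Submission
  imports Defs "HOL-Real_Asymp.Real_Asymp"
begin

text \<open>
  Let \<open>S k\<close> be the \<open>k\<close>-th coordinate of \<open>Z\<^sub>1 + \<dots> + Z\<^sub>N\<close>. Since
  \<open>1 - q = - 1 / (\<alpha> - 1)\<close>, the claim says that \<open>\<Sum>k. E \<bar>S k\<bar> powr q\<close> lies between constant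
  multiples of \<open>N / ln N\<close> and \<open>N\<close>. Almost surely \<open>S k\<close> is an integer: it is a sum of \<open>N\<close>
  independent centred variables with values in \<open>{-1, 0, 1}\<close>, each nonzero with probability
  \<open>p\<^sub>k\<close>.

  Because \<open>0 < q \<le> 2\<close>, an integer \<open>s\<close> satisfies \<open>1[s odd] \<le> \<bar>s\<bar> powr q \<le> s\<^sup>2\<close>, and both
  outer terms have explicit expectations. On the right, \<open>E (S k)\<^sup>2 = N p\<^sub>k\<close>, and summing over
  \<open>k\<close> gives the upper bound \<open>N\<close>. On the left, the parity of a sum of signs and zeros is the
  product of the factors \<open>1 - 2 x\<^sub>j\<^sup>2\<close>, so by independence
  \<open>P(S k odd) = (1 - (1 - 2 p\<^sub>k)^N) / 2\<close>, which is at least \<open>N p\<^sub>k / 2\<close> whenever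
  \<open>2 N p\<^sub>k \<le> 1\<close> (see \<open>sign_sum_moment_bounds\<close> and \<open>one_minus_power_lower_bound\<close>). For large
  \<open>N\<close> this covers all \<open>k \<ge> N\<close>, and the tail of \<open>p\<close> beyond \<open>N\<close> is at least \<open>C0 / ln N\<close>
  (\<open>p_seq_tail\<close>). The coordinates that are each hit rarely thus carry enough mass together
  to bring the expectation within a logarithm of its upper bound.

  The law of \<open>Z\<close> is only given as a measure on the Borel sets of the sequence space. Its
  coordinates can be used because coordinate maps are \<open>1\<close>-Lipschitz, and \<open>Z\<close> is measurable
  because \<open>t \<mapsto> t e\<^sub>k\<close> is an isometry for each of the countably many \<open>k\<close>.
\<close>

section \<open>The weights and their tail\<close>

text \<open>
  A discrete form of the fact that \<open>- 1 / (x (ln x)\<^sup>2)\<close> is the derivative of \<open>1 / ln x\<close>: the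
  weights compare with a telescoping series on both sides, which yields convergence as well as the
  size of the tail.
\<close>

lemma inverse_ln_diff_bounds:
  fixes k :: nat
  assumes "k \<ge> 2"
  shows "1 / (real (Suc k) * (ln (real (Suc k)))\<^sup>2) \<le> 1 / ln (real k) - 1 / ln (real (Suc k))"
    and "1 / ln (real k) - 1 / ln (real (Suc k)) \<le> 1 / (real k * (ln (real k))\<^sup>2)"
proof -
  define l m where "l = ln (real k)" and "m = ln (real (Suc k))"
  have lm: "0 < l" "l < m"
    using assms by (auto simp: l_def m_def)
  have "m - l = ln (1 + 1 / real k)"
    using assms ln_div[of "1 + real k" "real k"] by (simp add: m_def l_def add_divide_distrib add.commute)
  then have up: "m - l \<le> 1 / real k"
    using ln_add_one_self_le_self[of "1 / real k"] by simp
  have "l - m = ln (1 - 1 / real (Suc k))"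
    using assms ln_div[of "real k" "real (Suc k)"] by (simp add: m_def l_def diff_divide_eq_iff)
  also have "\<dots> \<le> - (1 / real (Suc k))"
    using ln_le_minus_one[of "1 - 1 / real (Suc k)"] assms by simp
  finally have lo: "1 / real (Suc k) \<le> m - l"
    by simp
  have eq: "1 / l - 1 / m = (m - l) / (l * m)"
    using lm by (simp add: field_simps)
  have "1 / (real (Suc k) * m\<^sup>2) = (1 / real (Suc k)) / (m * m)"
    by (simp add: power2_eq_square)
  also have "\<dots> \<le> (m - l) / (l * m)"
    using lm lo by (intro frac_le mult_right_mono) auto
  finally show "1 / (real (Suc k) * m\<^sup>2) \<le> 1 / l - 1 / m"
    using eq by simp
  have "(m - l) / (l * m) \<le> (1 / real k) / (l * l)"
    using lm up by (intro frac_le mult_left_mono) auto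
  also have "\<dots> = 1 / (real k * l\<^sup>2)"
    by (simp add: power2_eq_square)
  finally show "1 / l - 1 / m \<le> 1 / (real k * l\<^sup>2)"
    using eq by simp
qed

lemma inverse_ln_tendsto_0: "(\<lambda>n. 1 / ln (real (n + N))) \<longlonglongrightarrow> 0"
proof -
  have "(\<lambda>n. 1 / ln (real n)) \<longlonglongrightarrow> 0"
    by real_asymp
  then show ?thesis
    by (rule LIMSEQ_ignore_initial_segment)
qed

lemma inverse_ln_telescope:
  "(\<lambda>n. 1 / ln (real (n + N)) - 1 / ln (real (Suc (n + N)))) sums (1 / ln (real N))"
  using telescope_sums'[OF inverse_ln_tendsto_0[of N]] by simp

lemma summable_inverse_k_ln_square: "summable (\<lambda>k. 1 / (real k * (ln (real k))\<^sup>2))"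
proof -
  have "summable (\<lambda>n. 1 / (real (n + 3) * (ln (real (n + 3)))\<^sup>2))"
  proof (rule summable_comparison_test'[OF sums_summable[OF inverse_ln_telescope[of 2]], of 0])
    fix n :: nat
    show "norm (1 / (real (n + 3) * (ln (real (n + 3)))\<^sup>2))
        \<le> 1 / ln (real (n + 2)) - 1 / ln (real (Suc (n + 2)))"
      using inverse_ln_diff_bounds(1)[of "n + 2"] by (simp add: eval_nat_numeral)
  qed
  then show ?thesis
    by (subst (asm) summable_iff_shift)
qed

lemma inverse_k_ln_square_tail:
  assumes "N \<ge> 2"
  shows "1 / ln (real N) \<le> (\<Sum>n. 1 / (real (n + N) * (ln (real (n + N)))\<^sup>2))"
proof (rule sums_le[OF _ inverse_ln_telescope])
  show "1 / ln (real (n + N)) - 1 / ln (real (Suc (n + N)))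
      \<le> 1 / (real (n + N) * (ln (real (n + N)))\<^sup>2)" for n
    using inverse_ln_diff_bounds(2)[of "n + N"] assms by simp
  show "(\<lambda>n. 1 / (real (n + N) * (ln (real (n + N)))\<^sup>2)) sums
      (\<Sum>n. 1 / (real (n + N) * (ln (real (n + N)))\<^sup>2))"
    using summable_inverse_k_ln_square
    by (intro summable_sums) (subst summable_iff_shift)
qed

text \<open>
  The weight formula also vanishes at \<open>0\<close> and \<open>1\<close>, through division by zero, so that sums over
  all of \<^typ>\<open>nat\<close> agree with sums over \<open>k \<ge> 2\<close>.
\<close>

lemma C0_eq: "C0 = inverse (\<Sum>k. 1 / (real k * (ln (real k))\<^sup>2))"
proof -
  let ?a = "\<lambda>k::nat. 1 / (real k * (ln (real k))\<^sup>2)"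
  have "(?a has_sum suminf ?a) UNIV"
    using summable_inverse_k_ln_square by (intro norm_summable_imp_has_sum) auto
  also have "?this \<longleftrightarrow> (?a has_sum suminf ?a) {2..}"
  proof (rule has_sum_cong_neutral)
    fix k :: nat
    assume "k \<in> UNIV - {2..}"
    then have "k = 0 \<or> k = 1" by auto
    then show "?a k = 0" by auto
  qed auto
  finally show ?thesis
    by (simp add: C0_def infsumI)
qed

lemma C0_pos: "C0 > 0"
proof -
  have "0 < 1 / (real 2 * (ln (real 2))\<^sup>2)"
    by simp
  also have "\<dots> \<le> (\<Sum>k. 1 / (real k * (ln (real k))\<^sup>2))"
    using sum_le_suminf[OF summable_inverse_k_ln_square, of "{2}"] by simp
  finally show ?thesis
    by (simp add: C0_eq)
qed

lemma p_seq_nonneg: "0 \<le> p_seq k"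
  using C0_pos by (simp add: p_seq_def)

lemma p_seq_eq_0: "k < 2 \<Longrightarrow> p_seq k = 0"
  by (cases "k = 0") (auto simp: p_seq_def)

lemma p_seq_sums_1: "p_seq sums 1"
proof -
  have "(\<lambda>k. C0 * (1 / (real k * (ln (real k))\<^sup>2))) sums
      (C0 * (\<Sum>k. 1 / (real k * (ln (real k))\<^sup>2)))"
    using summable_inverse_k_ln_square by (intro sums_mult summable_sums)
  moreover have "C0 * (\<Sum>k. 1 / (real k * (ln (real k))\<^sup>2)) = 1"
    using C0_pos by (auto simp: C0_eq)
  ultimately show ?thesis
    by (simp add: p_seq_def[abs_def])
qed

lemma p_seq_tail:
  assumes "N \<ge> 2"
  shows "C0 / ln (real N) \<le> (\<Sum>n. p_seq (n + N))"
proof -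
  let ?a = "\<lambda>n. 1 / (real (n + N) * (ln (real (n + N)))\<^sup>2)"
  have "summable ?a"
    using summable_inverse_k_ln_square by (subst summable_iff_shift)
  then have "(\<Sum>n. p_seq (n + N)) = C0 * suminf ?a"
    by (subst suminf_mult[symmetric]) (auto simp: p_seq_def)
  then show ?thesis
    using mult_left_mono[OF inverse_k_ln_square_tail[OF assms], of C0] C0_pos by simp
qed

lemma p_seq_le:
  assumes "2 \<le> N" "N \<le> k"
  shows "p_seq k \<le> C0 / (real N * (ln (real N))\<^sup>2)"
  unfolding p_seq_def
  using assms C0_pos by (intro divide_left_mono mult_mono power_mono mult_pos_pos) auto

section \<open>Measurability in the sequence space\<close>

lemma space_lq_borel [simp]: "space (lq_borel q) = lq_space q"
  by (auto simp: lq_borel_def space_measure_of_conv)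

lemma openin_lq_imp_sets:
  assumes "q \<ge> 1" "openin (Metric_space.mtopology (lq_space q) (lq_dist q)) U"
  shows "U \<in> sets (lq_borel q)"
proof -
  interpret Metric_space "lq_space q" "lq_dist q"
    by (rule Metric_space_lq[OF assms(1)])
  have "{U. openin mtopology U} \<subseteq> Pow (lq_space q)"
    using openin_subset[of mtopology] by auto
  then show ?thesis
    using assms(2) by (auto simp: lq_borel_def)
qed

lemma abs_coordinate_le_lq_norm:
  assumes "q > 0" "x \<in> lq_space q"
  shows "\<bar>x k\<bar> \<le> lq_norm q x"
proof (cases "k < 2")
  case True
  then show ?thesis
    using assms lq_norm_nonneg[of q x] by (auto simp: lq_space_def)
next
  case False
  have "\<bar>x k\<bar> powr q \<le> (\<Sum>\<^sub>\<infinity>k\<in>{2..}. \<bar>x k\<bar> powr q)"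
    using finite_sum_le_infsum[of "\<lambda>k. \<bar>x k\<bar> powr q" "{2..}" "{k}"] assms False
    by (auto simp: lq_space_def)
  then have "(\<bar>x k\<bar> powr q) powr (1 / q) \<le> lq_norm q x"
    unfolding lq_norm_def using assms(1) by (intro powr_mono2) auto
  then show ?thesis
    using assms(1) by (simp add: powr_powr)
qed

lemma coordinate_measurable:
  assumes "q \<ge> 1"
  shows "(\<lambda>x. x k) \<in> borel_measurable (lq_borel q)"
proof (rule borel_measurableI)
  fix S :: "real set"
  assume "open S"
  interpret Metric_space "lq_space q" "lq_dist q"
    by (rule Metric_space_lq[OF assms])
  have "openin mtopology ((\<lambda>x. x k) -` S \<inter> lq_space q)"
    unfolding openin_mtopology
  proof safe
    fix x
    assume x: "x k \<in> S" "x \<in> lq_space q"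
    then obtain r where r: "r > 0" "ball (x k) r \<subseteq> S"
      using \<open>open S\<close> by (auto simp: open_contains_ball)
    have "mball x r \<subseteq> (\<lambda>x. x k) -` S \<inter> lq_space q"
    proof
      fix y
      assume "y \<in> mball x r"
      then have y: "y \<in> lq_space q" "lq_dist q x y < r"
        by auto
      have "\<bar>x k - y k\<bar> \<le> lq_dist q x y"
        using abs_coordinate_le_lq_norm[of q "\<lambda>i. x i - y i" k] lq_diff[of q x y] assms x y
        by (simp add: lq_dist_def)
      then have "y k \<in> ball (x k) r"
        using y by (simp add: dist_real_def)
      then show "y \<in> (\<lambda>x. x k) -` S \<inter> lq_space q"
        using r y by auto
    qed
    then show "\<exists>r>0. mball x r \<subseteq> (\<lambda>x. x k) -` S \<inter> lq_space q"
      using r by auto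
  qed
  then show "(\<lambda>x. x k) -` S \<inter> space (lq_borel q) \<in> sets (lq_borel q)"
    using openin_lq_imp_sets[OF assms] by simp
qed

lemma scaled_unit_vec:
  assumes "q > 0" "k \<ge> 2"
  shows "(\<lambda>i. t * unit_vec k i) \<in> lq_space q"
    and "lq_norm q (\<lambda>i. t * unit_vec k i) = \<bar>t\<bar>"
proof -
  have "((\<lambda>i. \<bar>t * unit_vec k i\<bar> powr q) has_sum \<bar>t\<bar> powr q) {k}"
    using has_sum_finite[of "{k}" "\<lambda>i. \<bar>t * unit_vec k i\<bar> powr q"] by (simp add: unit_vec_def)
  also have "?this \<longleftrightarrow> ((\<lambda>i. \<bar>t * unit_vec k i\<bar> powr q) has_sum \<bar>t\<bar> powr q) {2..}"
    using assms by (intro has_sum_cong_neutral) (auto simp: unit_vec_def)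
  finally have *: "((\<lambda>i. \<bar>t * unit_vec k i\<bar> powr q) has_sum \<bar>t\<bar> powr q) {2..}" .
  show "(\<lambda>i. t * unit_vec k i) \<in> lq_space q"
    using * assms by (auto simp: lq_space_def unit_vec_def has_sum_imp_summable)
  show "lq_norm q (\<lambda>i. t * unit_vec k i) = \<bar>t\<bar>"
    using infsumI[OF *] assms by (simp add: lq_norm_def powr_powr)
qed

text \<open>
  The sigma algebra is generated by the open sets of the norm, and the map is an isometry from the
  real line, so preimages of generators are open.
\<close>

lemma scaled_unit_vec_measurable:
  assumes "q \<ge> 1" "k \<ge> 2"
  shows "(\<lambda>t i. t * unit_vec k i) \<in> measurable borel (lq_borel q)"
  unfolding lq_borel_def
proof (rule measurable_measure_of)
  interpret Metric_space "lq_space q" "lq_dist q"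
    by (rule Metric_space_lq[OF assms(1)])
  show "{U. openin mtopology U} \<subseteq> Pow (lq_space q)"
    using openin_subset[of mtopology] by auto
  show "(\<lambda>t i. t * unit_vec k i) \<in> space borel \<rightarrow> lq_space q"
    using scaled_unit_vec(1)[of q k] assms by auto
  fix U
  assume "U \<in> {U. openin mtopology U}"
  then have U: "openin mtopology U" by simp
  have "open ((\<lambda>t i. t * unit_vec k i) -` U)"
    unfolding open_dist
  proof safe
    fix t
    assume "(\<lambda>i. t * unit_vec k i) \<in> U"
    then obtain r where r: "r > 0" "mball (\<lambda>i. t * unit_vec k i) r \<subseteq> U"
      using U by (auto simp: openin_mtopology)
    have "(\<lambda>i. s * unit_vec k i) \<in> U" if "dist s t < r" for s
    proof -
      have "lq_dist q (\<lambda>i. t * unit_vec k i) (\<lambda>i. s * unit_vec k i) = \<bar>t - s\<bar>"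
        using scaled_unit_vec(2)[of q k "t - s"] assms
        by (simp add: lq_dist_def left_diff_distrib)
      then have "(\<lambda>i. s * unit_vec k i) \<in> mball (\<lambda>i. t * unit_vec k i) r"
        using that scaled_unit_vec(1)[of q k] assms by (simp add: dist_real_def)
      then show ?thesis
        using r by auto
    qed
    then show "\<exists>e>0. \<forall>s. dist s t < e \<longrightarrow> s \<in> (\<lambda>t i. t * unit_vec k i) -` U"
      using r by auto
  qed
  then show "(\<lambda>t i. t * unit_vec k i) -` U \<inter> space borel \<in> sets borel"
    by simp
qed

text \<open>
  Split according to the countably many values of \<open>K\<close>: on each piece this is a function of
  \<open>e\<close> alone.
\<close>

lemma random_unit_vec_measurable:
  assumes "q \<ge> 1" and K: "K \<in> measurable M (count_space {2..})"
    and e: "e \<in> borel_measurable M"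
  shows "(\<lambda>\<omega> i. e \<omega> * unit_vec (K \<omega>) i) \<in> measurable M (lq_borel q)"
proof (rule measurable_compose_countable'[OF _ K])
  show "(\<lambda>\<omega> i. e \<omega> * unit_vec k i) \<in> measurable M (lq_borel q)" if "k \<in> {2..}" for k
    using measurable_compose[OF e scaled_unit_vec_measurable[of q k]] assms that by simp
qed auto

lemma lq_space_sum:
  assumes "q \<ge> 1" "finite J" "\<And>j. j \<in> J \<Longrightarrow> x j \<in> lq_space q"
  shows "(\<lambda>i. \<Sum>j\<in>J. x j i) \<in> lq_space q"
  using assms(2,3)
proof (induction J rule: finite_induct)
  case empty
  then show ?case
    by (simp add: lq_space_def)
next
  case (insert j J)
  then show ?case
    using lq_Minkowski(1)[OF assms(1), of "x j" "\<lambda>i. \<Sum>j\<in>J. x j i"] by simp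
qed

lemma lq_space_scale:
  assumes "x \<in> lq_space q"
  shows "(\<lambda>i. c * x i) \<in> lq_space q"
  using assms by (auto simp: lq_space_def abs_mult powr_mult intro!: summable_on_cmult_right)

lemma lq_norm_powr_sums:
  assumes "q > 0" "x \<in> lq_space q"
  shows "(\<lambda>k. \<bar>x k\<bar> powr q) sums (lq_norm q x powr q)"
proof -
  have "((\<lambda>k. \<bar>x k\<bar> powr q) has_sum lq_norm q x powr q) {2..}"
    using assms by (auto simp: lq_norm_powr lq_space_def)
  also have "?this \<longleftrightarrow> ((\<lambda>k. \<bar>x k\<bar> powr q) has_sum lq_norm q x powr q) UNIV"
    using assms by (intro has_sum_cong_neutral) (auto simp: lq_space_def)
  finally show ?thesis
    by (rule has_sum_imp_sums)
qed

section \<open>Moments of sums of independent signs\<close>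

text \<open>
  Each nonzero term flips the parity of the sum, and \<open>1 - 2 x\<^sup>2\<close> is \<open>-1\<close> for a nonzero
  term and \<open>1\<close> for a zero term. The point of this form is that it is a product, whose expectation
  factorises under independence.
\<close>

lemma sign_sum_parity:
  fixes x :: "'i \<Rightarrow> real"
  assumes "finite I" "\<And>i. i \<in> I \<Longrightarrow> x i \<in> {-1, 0, 1}"
  shows "\<exists>m::int. (\<Sum>i\<in>I. x i) = of_int m \<and> (\<Prod>i\<in>I. 1 - 2 * (x i)\<^sup>2) = (if even m then 1 else -1)"
  using assms
proof (induction I rule: finite_induct)
  case empty
  show ?case
    by (intro exI[of _ 0]) auto
next
  case (insert i I)
  then obtain m :: int where m: "(\<Sum>i\<in>I. x i) = of_int m"
    "(\<Prod>i\<in>I. 1 - 2 * (x i)\<^sup>2) = (if even m then 1 else -1)"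
    by auto
  obtain n :: int where n: "x i = of_int n" "n \<in> {-1, 0, 1}"
    using insert.prems[of i] by (auto intro: that[of "-1"] that[of 0] that[of 1])
  show ?case
    using m n insert.hyps by (intro exI[of _ "n + m"]) auto
qed

text \<open>
  The sum is an integer, hence zero or of absolute value at least \<open>1\<close>; the left side of the lower
  bound is the indicator of its being odd.
\<close>

lemma sign_sum_powr_bounds:
  fixes x :: "'i \<Rightarrow> real"
  assumes "finite I" "\<And>i. i \<in> I \<Longrightarrow> x i \<in> {-1, 0, 1}" and q: "0 < q" "q \<le> 2"
  shows "\<bar>\<Sum>i\<in>I. x i\<bar> powr q \<le> (\<Sum>i\<in>I. x i)\<^sup>2"
    and "(1 - (\<Prod>i\<in>I. 1 - 2 * (x i)\<^sup>2)) / 2 \<le> \<bar>\<Sum>i\<in>I. x i\<bar> powr q"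
proof -
  obtain m :: int where m: "(\<Sum>i\<in>I. x i) = of_int m"
    "(\<Prod>i\<in>I. 1 - 2 * (x i)\<^sup>2) = (if even m then 1 else -1)"
    using sign_sum_parity[of I x] assms(1,2) by blast
  have ge1: "1 \<le> \<bar>of_int m :: real\<bar>" if "m \<noteq> 0"
    using that by linarith
  show "\<bar>\<Sum>i\<in>I. x i\<bar> powr q \<le> (\<Sum>i\<in>I. x i)\<^sup>2"
  proof (cases "m = 0")
    case False
    have "\<bar>of_int m\<bar> powr q \<le> \<bar>of_int m :: real\<bar> powr 2"
      using q ge1[OF False] by (intro powr_mono) auto
    then show ?thesis
      using False by (simp add: m)
  qed (simp add: m)
  show "(1 - (\<Prod>i\<in>I. 1 - 2 * (x i)\<^sup>2)) / 2 \<le> \<bar>\<Sum>i\<in>I. x i\<bar> powr q"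
  proof (cases "even m")
    case False
    then have "m \<noteq> 0" by auto
    then show ?thesis
      using ge1 q False by (simp add: m ge_one_powr_ge_zero)
  qed (simp add: m)
qed

context prob_space
begin

lemma expectation_square_sum_indep_centered:
  fixes X :: "'i \<Rightarrow> 'a \<Rightarrow> real"
  assumes "finite I" "indep_vars (\<lambda>_. borel) X I"
    and "\<And>i. i \<in> I \<Longrightarrow> integrable M (X i)"
    and "\<And>i. i \<in> I \<Longrightarrow> integrable M (\<lambda>\<omega>. (X i \<omega>)\<^sup>2)"
    and "\<And>i. i \<in> I \<Longrightarrow> expectation (X i) = 0"
  shows "integrable M (\<lambda>\<omega>. (\<Sum>i\<in>I. X i \<omega>)\<^sup>2)"
    and "expectation (\<lambda>\<omega>. (\<Sum>i\<in>I. X i \<omega>)\<^sup>2) = (\<Sum>i\<in>I. expectation (\<lambda>\<omega>. (X i \<omega>)\<^sup>2))"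
proof -
  have "integrable M (\<lambda>\<omega>. (\<Sum>i\<in>I. X i \<omega>)\<^sup>2) \<and>
    expectation (\<lambda>\<omega>. (\<Sum>i\<in>I. X i \<omega>)\<^sup>2) = (\<Sum>i\<in>I. expectation (\<lambda>\<omega>. (X i \<omega>)\<^sup>2))"
    using assms
  proof (induction I rule: finite_induct)
    case empty
    then show ?case by simp
  next
    case (insert i I)
    let ?S = "\<lambda>\<omega>. \<Sum>i\<in>I. X i \<omega>"
    have IH: "integrable M (\<lambda>\<omega>. (?S \<omega>)\<^sup>2)"
      "expectation (\<lambda>\<omega>. (?S \<omega>)\<^sup>2) = (\<Sum>i\<in>I. expectation (\<lambda>\<omega>. (X i \<omega>)\<^sup>2))"
      using insert.IH insert.prems indep_vars_subset[OF insert.prems(1), of I] by auto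
    have ind: "indep_var borel (X i) borel ?S"
      by (rule indep_vars_sum[OF insert.hyps insert.prems(1)])
    have int: "integrable M (X i)" "integrable M ?S"
      using insert.prems by auto
    have prod: "integrable M (\<lambda>\<omega>. X i \<omega> * ?S \<omega>)" "expectation (\<lambda>\<omega>. X i \<omega> * ?S \<omega>) = 0"
      using indep_var_integrable[OF ind int] indep_var_lebesgue_integral[OF ind int]
        insert.prems(4)[of i] by auto
    have eq: "(\<Sum>i\<in>insert i I. X i \<omega>)\<^sup>2 = (X i \<omega>)\<^sup>2 + 2 * (X i \<omega> * ?S \<omega>) + (?S \<omega>)\<^sup>2" for \<omega>
      using insert.hyps by (simp add: power2_sum)
    show ?case
      unfolding eq using insert.hyps insert.prems(3)[of i] IH prod by simp
  qed
  then show "integrable M (\<lambda>\<omega>. (\<Sum>i\<in>I. X i \<omega>)\<^sup>2)"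
    and "expectation (\<lambda>\<omega>. (\<Sum>i\<in>I. X i \<omega>)\<^sup>2) = (\<Sum>i\<in>I. expectation (\<lambda>\<omega>. (X i \<omega>)\<^sup>2))"
    by auto
qed

text \<open>
  The two pointwise bounds integrated: variances add up for independent centred variables, and the
  expectation of the parity product is the product of the expectations.
\<close>

lemma sign_sum_moment_bounds:
  fixes X :: "'i \<Rightarrow> 'a \<Rightarrow> real"
  assumes I: "finite I" and ind: "indep_vars (\<lambda>_. borel) X I"
    and sign: "\<And>i. i \<in> I \<Longrightarrow> AE \<omega> in M. X i \<omega> \<in> {-1, 0, 1}"
    and mean: "\<And>i. i \<in> I \<Longrightarrow> expectation (X i) = 0"
    and q: "0 < q" "q \<le> 2"
  shows "integrable M (\<lambda>\<omega>. \<bar>\<Sum>i\<in>I. X i \<omega>\<bar> powr q)"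
    and "expectation (\<lambda>\<omega>. \<bar>\<Sum>i\<in>I. X i \<omega>\<bar> powr q) \<le> (\<Sum>i\<in>I. expectation (\<lambda>\<omega>. (X i \<omega>)\<^sup>2))"
    and "(1 - (\<Prod>i\<in>I. 1 - 2 * expectation (\<lambda>\<omega>. (X i \<omega>)\<^sup>2))) / 2
      \<le> expectation (\<lambda>\<omega>. \<bar>\<Sum>i\<in>I. X i \<omega>\<bar> powr q)"
proof -
  have meas [measurable]: "X i \<in> borel_measurable M" if "i \<in> I" for i
    using ind that by (auto simp: indep_vars_def)
  have int: "integrable M (X i)" "integrable M (\<lambda>\<omega>. (X i \<omega>)\<^sup>2)" if "i \<in> I" for i
    using that sign[OF that] by (auto intro!: integrable_const_bound[where B = 1])
  note square = expectation_square_sum_indep_centered[OF I ind int mean]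
  have sign_all: "AE \<omega> in M. \<forall>i\<in>I. X i \<omega> \<in> {-1, 0, 1}"
    using sign I by (simp add: AE_finite_all)
  have upper: "AE \<omega> in M. \<bar>\<Sum>i\<in>I. X i \<omega>\<bar> powr q \<le> (\<Sum>i\<in>I. X i \<omega>)\<^sup>2"
    using sign_all by eventually_elim (intro sign_sum_powr_bounds I q; blast)
  have lower: "AE \<omega> in M. (1 - (\<Prod>i\<in>I. 1 - 2 * (X i \<omega>)\<^sup>2)) / 2 \<le> \<bar>\<Sum>i\<in>I. X i \<omega>\<bar> powr q"
    using sign_all by eventually_elim (intro sign_sum_powr_bounds I q; blast)
  show powr_int: "integrable M (\<lambda>\<omega>. \<bar>\<Sum>i\<in>I. X i \<omega>\<bar> powr q)"
    by (rule Bochner_Integration.integrable_bound[OF square(1)]) (use upper in auto)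
  show "expectation (\<lambda>\<omega>. \<bar>\<Sum>i\<in>I. X i \<omega>\<bar> powr q) \<le> (\<Sum>i\<in>I. expectation (\<lambda>\<omega>. (X i \<omega>)\<^sup>2))"
    using integral_mono_AE[OF powr_int square(1) upper] by (simp only: square(2))
  have ind': "indep_vars (\<lambda>_. borel) (\<lambda>i \<omega>. 1 - 2 * (X i \<omega>)\<^sup>2) I"
    by (rule indep_vars_compose2[OF ind]) auto
  have int': "integrable M (\<lambda>\<omega>. 1 - 2 * (X i \<omega>)\<^sup>2)" if "i \<in> I" for i
    using int that by auto
  have "expectation (\<lambda>\<omega>. \<Prod>i\<in>I. 1 - 2 * (X i \<omega>)\<^sup>2) = (\<Prod>i\<in>I. expectation (\<lambda>\<omega>. 1 - 2 * (X i \<omega>)\<^sup>2))"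
    by (rule indep_vars_lebesgue_integral[OF I ind' int'])
  also have "\<dots> = (\<Prod>i\<in>I. 1 - 2 * expectation (\<lambda>\<omega>. (X i \<omega>)\<^sup>2))"
    using int by (intro prod.cong) (auto simp: prob_space)
  finally have prod_eq: "expectation (\<lambda>\<omega>. \<Prod>i\<in>I. 1 - 2 * (X i \<omega>)\<^sup>2) = \<dots>" .
  have prod_int: "integrable M (\<lambda>\<omega>. \<Prod>i\<in>I. 1 - 2 * (X i \<omega>)\<^sup>2)"
    by (rule indep_vars_integrable[OF I ind' int'])
  have "expectation (\<lambda>\<omega>. (1 - (\<Prod>i\<in>I. 1 - 2 * (X i \<omega>)\<^sup>2)) / 2)
      \<le> expectation (\<lambda>\<omega>. \<bar>\<Sum>i\<in>I. X i \<omega>\<bar> powr q)"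
    using prod_int by (intro integral_mono_AE[OF _ powr_int lower]) auto
  then show "(1 - (\<Prod>i\<in>I. 1 - 2 * expectation (\<lambda>\<omega>. (X i \<omega>)\<^sup>2))) / 2
      \<le> expectation (\<lambda>\<omega>. \<bar>\<Sum>i\<in>I. X i \<omega>\<bar> powr q)"
    using prod_int prod_eq by (simp add: prob_space)
qed

text \<open>
  Up to null sets the \<open>k\<close>-th coordinate is \<open>e\<close> times the indicator of \<open>K = k\<close>. Independence
  centres it, and \<open>e\<^sup>2 = 1\<close> leaves only the indicator in the second moment.
\<close>

lemma random_unit_vec_coordinate:
  fixes K :: "'a \<Rightarrow> nat" and e :: "'a \<Rightarrow> real"
  assumes ind: "indep_var borel (\<lambda>\<omega>. real (K \<omega>)) borel e"
    and e: "\<P>(\<omega> in M. e \<omega> = 1) = 1 / 2" "\<P>(\<omega> in M. e \<omega> = -1) = 1 / 2"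
  shows "AE \<omega> in M. e \<omega> * unit_vec (K \<omega>) k \<in> {-1, 0, 1}"
    and "expectation (\<lambda>\<omega>. e \<omega> * unit_vec (K \<omega>) k) = 0"
    and "expectation (\<lambda>\<omega>. (e \<omega> * unit_vec (K \<omega>) k)\<^sup>2) = \<P>(\<omega> in M. K \<omega> = k)"
proof -
  have [measurable]: "e \<in> borel_measurable M" "(\<lambda>\<omega>. real (K \<omega>)) \<in> borel_measurable M"
    using indep_var_rv1[OF ind] indep_var_rv2[OF ind] by auto
  have set_eq: "{\<omega>\<in>space M. K \<omega> = k} = {\<omega>\<in>space M. real (K \<omega>) = real k}"
    by simp
  have [measurable]: "{\<omega>\<in>space M. K \<omega> = k} \<in> events"
    unfolding set_eq by measurable
  have "prob ({\<omega>\<in>space M. e \<omega> = 1} \<union> {\<omega>\<in>space M. e \<omega> = -1}) = 1"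
    using e by (subst finite_measure_Union) auto
  then have "AE \<omega> in M. \<omega> \<in> {\<omega>\<in>space M. e \<omega> = 1} \<union> {\<omega>\<in>space M. e \<omega> = -1}"
    by (subst (asm) prob_eq_1) auto
  then have e_sign: "AE \<omega> in M. e \<omega> = 1 \<or> e \<omega> = -1"
    by eventually_elim auto
  then show "AE \<omega> in M. e \<omega> * unit_vec (K \<omega>) k \<in> {-1, 0, 1}"
    by eventually_elim (auto simp: unit_vec_def)
  \<comment> \<open>The law of \<open>e\<close> is known only at two points, so \<open>e\<close> is first written as a simple function.\<close>
  have "AE \<omega> in M. e \<omega> = indicator {\<omega>\<in>space M. e \<omega> = 1} \<omega> - indicator {\<omega>\<in>space M. e \<omega> = -1} \<omega>"
    using e_sign AE_space by eventually_elim (auto simp: indicator_def)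
  then have "expectation e
      = expectation (\<lambda>\<omega>. indicator {\<omega>\<in>space M. e \<omega> = 1} \<omega> - indicator {\<omega>\<in>space M. e \<omega> = -1} \<omega>)"
    by (intro integral_cong_AE) auto
  also have "\<dots> = 0"
    using e by (subst Bochner_Integration.integral_diff) (auto simp: emeasure_eq_measure)
  finally have mean: "expectation e = 0" .
  have ind': "indep_var borel (\<lambda>\<omega>. indicator {real k} (real (K \<omega>)) :: real) borel e"
  proof -
    have "(indicator {real k} :: real \<Rightarrow> real) \<in> borel_measurable borel"
      "(\<lambda>x::real. x) \<in> borel_measurable borel"
      by measurable
    from indep_var_compose[OF ind this] show ?thesis
      by (simp only: comp_def)
  qed
  have "AE \<omega> in M. norm (e \<omega>) \<le> 1"
    using e_sign by eventually_elim auto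
  then have int: "integrable M (\<lambda>\<omega>. indicator {real k} (real (K \<omega>)) :: real)" "integrable M e"
    by (auto intro!: integrable_const_bound[where B = 1] simp: indicator_def)
  have "expectation (\<lambda>\<omega>. e \<omega> * unit_vec (K \<omega>) k)
      = expectation (\<lambda>\<omega>. indicator {real k} (real (K \<omega>)) * e \<omega>)"
    by (intro Bochner_Integration.integral_cong) (auto simp: unit_vec_def indicator_def)
  then show "expectation (\<lambda>\<omega>. e \<omega> * unit_vec (K \<omega>) k) = 0"
    using indep_var_lebesgue_integral[OF ind' int] mean by simp
  have uv [measurable]: "(\<lambda>\<omega>. unit_vec (K \<omega>) k) \<in> borel_measurable M"
  proof -
    have "(\<lambda>\<omega>. unit_vec (K \<omega>) k) = (\<lambda>\<omega>. indicator {real k} (real (K \<omega>)))"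
      by (auto simp: unit_vec_def indicator_def)
    then show ?thesis by simp
  qed
  have "AE \<omega> in M. (e \<omega> * unit_vec (K \<omega>) k)\<^sup>2 = indicator {\<omega>\<in>space M. K \<omega> = k} \<omega>"
    using e_sign AE_space by eventually_elim (auto simp: unit_vec_def indicator_def)
  then have "expectation (\<lambda>\<omega>. (e \<omega> * unit_vec (K \<omega>) k)\<^sup>2)
      = expectation (indicator {\<omega>\<in>space M. K \<omega> = k})"
    by (intro integral_cong_AE) auto
  then show "expectation (\<lambda>\<omega>. (e \<omega> * unit_vec (K \<omega>) k)\<^sup>2) = \<P>(\<omega> in M. K \<omega> = k)"
    by simp
qed

end

text \<open>
  With \<open>x = 2 N p \<le> 1\<close> this is \<open>(1 - 2 p)^N \<le> exp (- x) \<le> 1 / (1 + x) \<le> 1 - x / 2\<close>: a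
  coordinate that is rarely hit has an odd sum essentially as often as it is hit.
\<close>

lemma one_minus_power_lower_bound:
  fixes p :: real
  assumes "0 \<le> p" "2 * real N * p \<le> 1"
  shows "real N * p / 2 \<le> (1 - (1 - 2 * p) ^ N) / 2"
proof (cases "N = 0")
  case False
  define x where "x = 2 * real N * p"
  have x: "0 \<le> x" "x \<le> 1"
    using assms by (auto simp: x_def)
  have "2 * p \<le> 2 * real N * p"
    using False assms(1) by (intro mult_right_mono) auto
  then have "0 \<le> 1 - 2 * p"
    using assms by simp
  then have "(1 - 2 * p) ^ N \<le> exp (- 2 * p) ^ N"
    using exp_ge_add_one_self[of "- 2 * p"] by (intro power_mono) auto
  also have "\<dots> = exp (- x)"
    by (simp add: x_def exp_of_nat_mult[symmetric] mult_ac)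
  also have "\<dots> = 1 / exp x"
    by (simp add: exp_minus field_simps)
  also have "\<dots> \<le> 1 / (1 + x)"
    using x exp_ge_add_one_self[of x] by (intro divide_left_mono) auto
  also have "\<dots> \<le> 1 - x / 2"
    using x mult_left_mono[of x 1 x] by (simp add: field_simps)
  finally show ?thesis
    by (simp add: x_def)
qed simp

section \<open>The empirical mean\<close>

theorem proposition2p15:
  fixes \<alpha> q :: real
    and M :: "'a measure" and K :: "'a \<Rightarrow> nat" and \<epsilon> :: "'a \<Rightarrow> real" and Z :: "'a \<Rightarrow> nat \<Rightarrow> real"
    and M' :: "'b measure" and Zs :: "nat \<Rightarrow> 'b \<Rightarrow> nat \<Rightarrow> real"
    and Zbar :: "nat \<Rightarrow> 'b \<Rightarrow> nat \<Rightarrow> real"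
  assumes alpha: "\<alpha> \<ge> 2"
    and q: "q = \<alpha> / (\<alpha> - 1)"
    and M: "prob_space M"
    and K: "K \<in> measurable M (count_space {2..})"
    and K_distr: "\<And>k. k \<ge> 2 \<Longrightarrow> \<P>(\<omega> in M. K \<omega> = k) = p_seq k"
    and eps: "\<epsilon> \<in> borel_measurable M"
    and eps_distr: "\<P>(\<omega> in M. \<epsilon> \<omega> = 1) = 1 / 2" "\<P>(\<omega> in M. \<epsilon> \<omega> = -1) = 1 / 2"
    and indep: "prob_space.indep_var M borel (\<lambda>\<omega>. real (K \<omega>)) borel \<epsilon>"
    and Z: "\<And>\<omega>. Z \<omega> = (\<lambda>i. \<epsilon> \<omega> * unit_vec (K \<omega>) i)"
    and M': "prob_space M'"
    and Zs_indep: "prob_space.indep_vars M' (\<lambda>_. lq_borel q) Zs {1..}"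
    and Zs_distr: "\<And>j. j \<ge> 1 \<Longrightarrow> distr M' (lq_borel q) (Zs j) = distr M (lq_borel q) Z"
    and Zbar: "\<And>N \<omega>. Zbar N \<omega> = (\<lambda>i. (1 / real N) * (\<Sum>j = 1..N. Zs j \<omega> i))"
  shows "\<exists>N0 :: nat. \<exists>c > 0. \<exists>C > 0. \<forall>N \<ge> N0.
           c * (real N powr (- 1 / (\<alpha> - 1)) * inverse (ln (real N)))
             \<le> prob_space.expectation M' (\<lambda>\<omega>. lq_norm q (Zbar N \<omega>) powr q)
         \<and> prob_space.expectation M' (\<lambda>\<omega>. lq_norm q (Zbar N \<omega>) powr q)
             \<le> C * real N powr (- 1 / (\<alpha> - 1))"
proof -
  interpret M: prob_space M by (rule M)
  interpret M': prob_space M' by (rule M')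
  have q12: "1 < q" "q \<le> 2" and exponent: "- 1 / (\<alpha> - 1) = 1 - q"
    using alpha by (auto simp: q field_simps)
  then have q1: "q \<ge> 1" and q0: "q > 0"
    by auto
  have coord [measurable]: "(\<lambda>x. x k) \<in> borel_measurable (lq_borel q)" for k
    by (rule coordinate_measurable[OF q1])
  have Z_eq: "Z = (\<lambda>\<omega> i. \<epsilon> \<omega> * unit_vec (K \<omega>) i)"
    using Z by (intro ext) simp
  have Z_meas [measurable]: "Z \<in> measurable M (lq_borel q)"
    unfolding Z_eq by (rule random_unit_vec_measurable[OF q1 K eps])
  have Zs_meas [measurable]: "Zs j \<in> measurable M' (lq_borel q)" if "j \<ge> 1" for j
    using Zs_indep that by (auto simp: M'.indep_vars_def)
  have K_prob: "\<P>(\<omega> in M. K \<omega> = k) = p_seq k" for k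
  proof (cases "k < 2")
    case True
    then have "{\<omega>\<in>space M. K \<omega> = k} = {}"
      using measurable_space[OF K] by force
    then show ?thesis
      using True by (simp only: p_seq_eq_0 measure_empty)
  qed (use K_distr in simp)
  note coordinate = M.random_unit_vec_coordinate[OF indep eps_distr]
  \<comment> \<open>The copies \<open>Zs j\<close> live on another probability space, so what is known about the coordinates
    of \<open>Z\<close> is carried over through the common law on \<open>lq_borel q\<close>.\<close>
  have Zs_sign: "AE \<omega> in M'. Zs j \<omega> k \<in> {-1, 0, 1}" if "j \<ge> 1" for j k
  proof -
    have set: "{x \<in> space (lq_borel q). x k \<in> {-1, 0, 1}} \<in> sets (lq_borel q)"
      by measurable
    have "AE \<omega> in M. Z \<omega> k \<in> {-1, 0, 1}"
      unfolding Z_eq by (rule coordinate(1))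
    then have "AE x in distr M (lq_borel q) Z. x k \<in> {-1, 0, 1}"
      by (simp only: AE_distr_iff[OF Z_meas set])
    then show ?thesis
      by (simp only: Zs_distr[OF that, symmetric] AE_distr_iff[OF Zs_meas[OF that] set])
  qed
  have Zs_mean: "M'.expectation (\<lambda>\<omega>. Zs j \<omega> k) = 0" if "j \<ge> 1" for j k
  proof -
    have "M'.expectation (\<lambda>\<omega>. Zs j \<omega> k) = (\<integral>x. x k \<partial>distr M' (lq_borel q) (Zs j))"
      using that by (intro integral_distr[symmetric]) auto
    also have "\<dots> = M.expectation (\<lambda>\<omega>. Z \<omega> k)"
      unfolding Zs_distr[OF that] by (intro integral_distr) auto
    finally show ?thesis
      using coordinate(2) by (simp add: Z_eq)
  qed
  have Zs_square: "M'.expectation (\<lambda>\<omega>. (Zs j \<omega> k)\<^sup>2) = p_seq k" if "j \<ge> 1" for j k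
  proof -
    have "M'.expectation (\<lambda>\<omega>. (Zs j \<omega> k)\<^sup>2) = (\<integral>x. (x k)\<^sup>2 \<partial>distr M' (lq_borel q) (Zs j))"
      using that by (intro integral_distr[symmetric]) auto
    also have "\<dots> = M.expectation (\<lambda>\<omega>. (Z \<omega> k)\<^sup>2)"
      unfolding Zs_distr[OF that] by (intro integral_distr) auto
    finally show ?thesis
      using coordinate(3) K_prob by (simp add: Z_eq)
  qed
  define X where "X N k \<omega> = \<bar>\<Sum>j = 1..N. Zs j \<omega> k\<bar> powr q" for N k \<omega>
  have X_int: "integrable M' (X N k)"
    and X_upper: "M'.expectation (X N k) \<le> real N * p_seq k"
    and X_lower: "(1 - (1 - 2 * p_seq k) ^ N) / 2 \<le> M'.expectation (X N k)" for N k
  proof -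
    have ind: "M'.indep_vars (\<lambda>_. borel) (\<lambda>j \<omega>. Zs j \<omega> k) {1..N}"
      using M'.indep_vars_subset[OF M'.indep_vars_compose2[OF Zs_indep, of "\<lambda>_ x. x k" "\<lambda>_. borel"]]
      by auto
    note bounds = M'.sign_sum_moment_bounds[OF finite_atLeastAtMost ind _ _ q0 q12(2)]
    show "integrable M' (X N k)"
      unfolding X_def using bounds(1) Zs_sign Zs_mean by simp
    show "M'.expectation (X N k) \<le> real N * p_seq k"
      unfolding X_def using bounds(2) Zs_sign Zs_mean Zs_square by simp
    show "(1 - (1 - 2 * p_seq k) ^ N) / 2 \<le> M'.expectation (X N k)"
      unfolding X_def using bounds(3) Zs_sign Zs_mean Zs_square by simp
  qed
  have X_nonneg: "0 \<le> X N k \<omega>" for N k \<omega>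
    by (simp add: X_def)
  have norm_eq: "(\<lambda>k. X N k \<omega>) sums (real N powr q * lq_norm q (Zbar N \<omega>) powr q)"
    if "N \<ge> 1" "\<omega> \<in> space M'" for N \<omega>
  proof -
    have "Zs j \<omega> \<in> lq_space q" if "j \<in> {1..N}" for j
      using measurable_space[OF Zs_meas, of j \<omega>] that \<open>\<omega> \<in> space M'\<close> by simp
    then have "(\<lambda>k. \<Sum>j = 1..N. Zs j \<omega> k) \<in> lq_space q"
      by (intro lq_space_sum q1) auto
    then have "Zbar N \<omega> \<in> lq_space q"
      unfolding Zbar by (rule lq_space_scale)
    then have "(\<lambda>k. real N powr q * \<bar>Zbar N \<omega> k\<bar> powr q) sums
        (real N powr q * lq_norm q (Zbar N \<omega>) powr q)"
      by (intro sums_mult lq_norm_powr_sums q0)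
    moreover have "real N powr q * \<bar>Zbar N \<omega> k\<bar> powr q = X N k \<omega>" for k
      using that by (simp add: Zbar X_def powr_mult[symmetric] abs_mult)
    ultimately show ?thesis
      by simp
  qed
  have p_summable: "summable (\<lambda>k. real N * p_seq k)" for N
    using p_seq_sums_1 by (intro summable_mult) (auto simp: sums_iff)
  have EX_summable: "summable (\<lambda>k. M'.expectation (X N k))" for N
    using X_upper X_nonneg
    by (intro summable_comparison_test'[OF p_summable[of N], of 0]) (auto simp: integral_nonneg)
  have expectation_eq: "real N powr q * M'.expectation (\<lambda>\<omega>. lq_norm q (Zbar N \<omega>) powr q)
      = (\<Sum>k. M'.expectation (X N k))" if "N \<ge> 1" for N
  proof -
    have "(\<Sum>k. M'.expectation (X N k)) = M'.expectation (\<lambda>\<omega>. \<Sum>k. X N k \<omega>)"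
      using X_int norm_eq[OF that] X_nonneg EX_summable
      by (intro integral_suminf[symmetric] AE_I2) (auto simp: sums_iff)
    also have "\<dots> = M'.expectation (\<lambda>\<omega>. real N powr q * lq_norm q (Zbar N \<omega>) powr q)"
      using norm_eq[OF that] by (intro Bochner_Integration.integral_cong) (auto simp: sums_iff)
    finally show ?thesis
      by simp
  qed
  have upper: "(\<Sum>k. M'.expectation (X N k)) \<le> real N" for N
  proof -
    have "(\<Sum>k. M'.expectation (X N k)) \<le> (\<Sum>k. real N * p_seq k)"
      by (rule suminf_le[OF X_upper EX_summable p_summable])
    also have "\<dots> = real N"
      using p_seq_sums_1 by (simp add: suminf_mult sums_iff)
    finally show ?thesis .
  qed
  \<comment> \<open>This threshold makes \<open>2 N p\<^sub>k \<le> 1\<close> for all \<open>k \<ge> N\<close>, as \<open>p\<^sub>k \<le> C0 / (N (ln N)\<^sup>2)\<close> there.\<close>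
  obtain N0 :: nat where N0: "N0 \<ge> 2" "\<And>N. N \<ge> N0 \<Longrightarrow> 2 * C0 \<le> (ln (real N))\<^sup>2"
  proof -
    have "filterlim (\<lambda>n. (ln (real n))\<^sup>2) at_top sequentially"
      by real_asymp
    then obtain n where "\<And>N. N \<ge> n \<Longrightarrow> 2 * C0 \<le> (ln (real N))\<^sup>2"
      by (auto simp: filterlim_at_top eventually_sequentially)
    then show ?thesis
      by (intro that[of "max n 2"]) auto
  qed
  have lower: "C0 / 2 * (real N / ln (real N)) \<le> (\<Sum>k. M'.expectation (X N k))" if "N \<ge> N0" for N
  proof -
    have N2: "N \<ge> 2"
      using that N0 by simp
    have term_le: "real N / 2 * p_seq (n + N) \<le> M'.expectation (X N (n + N))" for n
    proof -
      have "2 * real N * p_seq (n + N) \<le> 2 * real N * (C0 / (real N * (ln (real N))\<^sup>2))"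
        using p_seq_le[OF N2, of "n + N"] by (intro mult_left_mono) auto
      also have "\<dots> \<le> 1"
        using N0(2)[OF that] N2 by (simp add: field_simps)
      finally show ?thesis
        using one_minus_power_lower_bound[OF p_seq_nonneg, of N "n + N"] X_lower[of "n + N" N]
        by simp
    qed
    have ps: "summable (\<lambda>n. p_seq (n + N))"
      using p_seq_sums_1 by (subst summable_iff_shift) (auto simp: sums_iff)
    have Xs: "summable (\<lambda>n. M'.expectation (X N (n + N)))"
      using EX_summable by (subst summable_iff_shift)
    have "C0 / 2 * (real N / ln (real N)) = real N / 2 * (C0 / ln (real N))"
      by simp
    also have "\<dots> \<le> real N / 2 * (\<Sum>n. p_seq (n + N))"
      by (intro mult_left_mono p_seq_tail N2) simp
    also have "\<dots> = (\<Sum>n. real N / 2 * p_seq (n + N))"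
      by (rule suminf_mult[OF ps, symmetric])
    also have "\<dots> \<le> (\<Sum>n. M'.expectation (X N (n + N)))"
      by (intro suminf_le term_le Xs summable_mult ps)
    also have "\<dots> \<le> (\<Sum>n. M'.expectation (X N (n + N))) + (\<Sum>k<N. M'.expectation (X N k))"
      using X_nonneg by (simp add: sum_nonneg integral_nonneg)
    also have "\<dots> = (\<Sum>k. M'.expectation (X N k))"
      by (rule suminf_split_initial_segment[OF EX_summable, symmetric])
    finally show ?thesis .
  qed
  have "C0 / 2 * (real N powr (- 1 / (\<alpha> - 1)) * inverse (ln (real N)))
        \<le> M'.expectation (\<lambda>\<omega>. lq_norm q (Zbar N \<omega>) powr q)
      \<and> M'.expectation (\<lambda>\<omega>. lq_norm q (Zbar N \<omega>) powr q)
        \<le> 1 * real N powr (- 1 / (\<alpha> - 1))" if "N \<ge> N0" for N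
  proof -
    have N: "real N > 0" "N \<ge> 1"
      using that N0 by auto
    have pw: "real N powr (- 1 / (\<alpha> - 1)) = real N / real N powr q"
      unfolding exponent using N by (simp add: powr_diff)
    have E: "M'.expectation (\<lambda>\<omega>. lq_norm q (Zbar N \<omega>) powr q)
        = (\<Sum>k. M'.expectation (X N k)) / real N powr q"
      using expectation_eq[OF N(2)] N by (simp add: nonzero_eq_divide_eq mult.commute)
    have "C0 / 2 * (real N / real N powr q * inverse (ln (real N)))
        = C0 / 2 * (real N / ln (real N)) / real N powr q"
      by (simp only: divide_inverse mult_ac)
    also have "\<dots> \<le> (\<Sum>k. M'.expectation (X N k)) / real N powr q"
      using lower[OF that] by (rule divide_right_mono) simp
    finally show ?thesis
      unfolding pw E using divide_right_mono[OF upper[of N], of "real N powr q"] by simp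
  qed
  then show ?thesis
    using C0_pos by (intro exI[of _ N0] exI[of _ "C0 / 2"] exI[of _ 1] conjI) auto
qed

end
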